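(* Let $f$ be an inner function with $f(0)=0$ which is not a rotation and let $\{a_{n}\}_{n\ge1}$ be a bounded sequence of complex numbers. Then $F=\sum_{n=1}^{\infty} a_{n}f^{n}\in\mathcal{B}$ and there exists a constant $C=C(f)>0$, depending only on $f$, such that $\|F\|_{\mathcal{B}}\le C \sup_{n \geq 1}|a_{n}|$.
   Context: $\mathbb{D}$ is the open unit disc and $\partial\mathbb{D}$ the unit circle. An inner function is an analytic mapping $f:\mathbb{D}\to\mathbb{D}$ whose radial limits have modulus one at almost every point of $\partial\mathbb{D}$. A rotation is a map $z\mapsto \lambda z$ with $|\lambda|=1$. $f^{n}$ denotes the $n$-th iterate of $f$ (not the power). For bounded $\{a_n\}$ the series $\sum a_nf^n$ converges uniformly on compact subsets of $\mathbb{D}$, and $F$ is its sum. $\mathcal{B}$ is the Bloch space of analytic functions $g$ in $\mathbb{D}$ with $\|g\|_{\mathcal{B}}=\sup_{z\in\mathbb{D}} (1-|z|^{2}) |g'(z)|<\infty$. *)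

theory Defs
  imports "HOL-Complex_Analysis.Complex_Analysis"
begin

text \<open>
  Functions on the open unit disc are represented by total functions on the complex plane;
  only their values on \<open>ball 0 1\<close> matter.
\<close>

text \<open>
  Almost every point of the unit circle is understood with respect to arc length, that is, for
  Lebesgue-almost every angle \<open>t\<close> in \<open>[0, 2\<pi>]\<close>. The existence of the radial limit is
  part of the condition.
\<close>

definition inner_function :: "(complex \<Rightarrow> complex) \<Rightarrow> bool" where
  "inner_function f \<longleftrightarrow>
     f holomorphic_on ball 0 1 \<and> f ` ball 0 1 \<subseteq> ball 0 1 \<and>
     (AE t in lebesgue_on {0..2 * pi}.
        \<exists>l. ((\<lambda>r. f (complex_of_real r * cis t)) \<longlongrightarrow> l) (at_left 1) \<and> cmod l = 1)"

definition is_rotation :: "(complex \<Rightarrow> complex) \<Rightarrow> bool" where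
  "is_rotation f \<longleftrightarrow> (\<exists>c. cmod c = 1 \<and> (\<forall>z\<in>ball 0 1. f z = c * z))"

definition bloch_space :: "(complex \<Rightarrow> complex) set" where
  "bloch_space =
     {g. g holomorphic_on ball 0 1 \<and>
         bdd_above ((\<lambda>z. (1 - (cmod z)\<^sup>2) * cmod (deriv g z)) ` ball 0 1)}"

text \<open>The supremum is meaningful for members of \<^const>\<open>bloch_space\<close> only.\<close>

definition bloch_norm :: "(complex \<Rightarrow> complex) \<Rightarrow> real" where
  "bloch_norm g = (SUP z\<in>ball 0 1. (1 - (cmod z)\<^sup>2) * cmod (deriv g z))"

text \<open>
  The series \<open>\<Sum>n\<ge>1. a n * f\<^sup>n\<close>, where \<open>f\<^sup>n\<close> is the \<open>n\<close>-th iterate; the value \<open>a 0\<close> is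
  never used.
\<close>

definition iterate_series :: "(nat \<Rightarrow> complex) \<Rightarrow> (complex \<Rightarrow> complex) \<Rightarrow> complex \<Rightarrow> complex" where
  "iterate_series a f z = (\<Sum>n. a (Suc n) * (f ^^ Suc n) z)"

end

theory Submission
  imports Defs
begin

text \<open>
  Writing \<open>f z = z * h z\<close> with \<open>\<bar>h\<bar> < 1\<close>, the
  Schwarz--Pick inequality for \<open>h\<close> yields \<open>1 - \<bar>h z\<bar> \<ge> c * (1 - \<bar>z\<bar>)\<close> for some \<open>c > 0\<close>. Hence \<open>1 - \<bar>f\<^sup>n z\<bar>\<close> grows
  geometrically as long as the orbit stays in \<open>\<bar>w\<bar> > 1/2\<close>, and \<open>f\<^sup>n\<close> decays geometrically on compact
  subsets. Since \<open>(1 - \<bar>z\<bar>\<^sup>2) * \<bar>(f\<^sup>n)' z\<bar> \<le> 1 - \<bar>f\<^sup>n z\<bar>\<^sup>2\<close>, the sum of the terms on the left is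
  bounded uniformly in \<open>z\<close>.
\<close>

section \<open>Moebius maps, Schwarz--Pick estimates and the contraction property of
  \<open>f\<close>\<close>

lemma one_minus_cnj_mult_nonzero:
  fixes w z :: complex
  assumes "norm w < 1" "norm z < 1"
  shows "1 - cnj w * z \<noteq> 0"
proof
  assume "1 - cnj w * z = 0"
  then have "norm (cnj w * z) = 1" by simp
  then show False
    using norm_mult_less[of "cnj w" 1 z 1] assms by simp
qed

lemma one_minus_norm_Moebius_function:
  assumes "norm w < 1" "norm z < 1"
  shows "1 - (norm (Moebius_function 0 w z))\<^sup>2
       = (1 - (norm w)\<^sup>2) * (1 - (norm z)\<^sup>2) / (norm (1 - cnj w * z))\<^sup>2"
proof -
  have nz: "norm (1 - cnj w * z) \<noteq> 0"
    using one_minus_cnj_mult_nonzero[OF assms] by simp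
  have "(norm (1 - cnj w * z))\<^sup>2 - (norm (z - w))\<^sup>2 = (1 - (norm w)\<^sup>2) * (1 - (norm z)\<^sup>2)"
    unfolding cmod_power2 by (simp add: algebra_simps power2_eq_square)
  then show ?thesis
    using nz by (simp add: Moebius_function_simple norm_divide power_divide field_simps)
qed

lemma Moebius_function_has_field_derivative:
  assumes "norm w < 1" "norm z < 1"
  shows "(Moebius_function 0 w has_field_derivative (1 - (norm w)\<^sup>2) / (1 - cnj w * z)\<^sup>2) (at z)"
proof -
  have eq: "of_real ((norm w)\<^sup>2) = w * cnj w"
    by (metis complex_norm_square of_real_power)
  show ?thesis
    unfolding Moebius_function_simple[abs_def]
    apply (rule derivative_eq_intros refl one_minus_cnj_mult_nonzero[OF assms])+
    using eq by (simp add: algebra_simps power2_eq_square)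
qed

text \<open>Following \<open>h\<close> by the Moebius map that sends \<open>h 0\<close> to 0 gives a
  function to which the Schwarz lemma applies; \<open>one_minus_norm_Moebius_function\<close> then
  turns its bound into one on \<open>1 - (norm (h z))\<^sup>2\<close>. The 4 is 2 * 2, from
  \<open>1 + norm b \<le> 2\<close> and \<open>1 - x\<^sup>2 \<le> 2 * (1 - x)\<close>.\<close>

lemma Schwarz_Pick_gap:
  assumes h: "h holomorphic_on ball 0 1"
    and lt: "\<And>z. norm z < 1 \<Longrightarrow> norm (h z) < 1"
    and z: "norm z < 1"
  shows "(1 - norm (h 0)) / 4 * (1 - norm z) \<le> 1 - norm (h z)"
proof -
  define b where "b = h 0"
  have b: "norm b < 1" unfolding b_def using lt by simp
  define g where "g = Moebius_function 0 b \<circ> h"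
  have "norm (g z) \<le> norm z"
  proof (rule Schwarz_Lemma(1)[OF _ _ _ z])
    show "g holomorphic_on ball 0 1"
      unfolding g_def
      by (rule holomorphic_on_compose_gen[OF h Moebius_function_holomorphic[OF b]])
         (use lt in auto)
    show "g 0 = 0" by (simp add: g_def b_def Moebius_function_eq_zero)
    show "norm (g w) < 1" if "norm w < 1" for w
      unfolding g_def using Moebius_function_norm_lt_1[OF b lt[OF that]] by simp
  qed
  then have "(norm (g z))\<^sup>2 \<le> (norm z)\<^sup>2" by (simp add: power_mono)
  then have "1 - (norm z)\<^sup>2 \<le> 1 - (norm (g z))\<^sup>2" by simp
  also have "\<dots> = (1 - (norm b)\<^sup>2) * (1 - (norm (h z))\<^sup>2) / (norm (1 - cnj b * h z))\<^sup>2"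
    unfolding g_def using one_minus_norm_Moebius_function[OF b lt[OF z]] by simp
  finally have main: "(1 - (norm z)\<^sup>2) * (norm (1 - cnj b * h z))\<^sup>2
      \<le> (1 - (norm b)\<^sup>2) * (1 - (norm (h z))\<^sup>2)"
    using one_minus_cnj_mult_nonzero[OF b lt[OF z]] by (simp add: field_simps)
  have "norm b * norm (h z) \<le> norm b"
    using lt[OF z] by (simp add: mult_left_le)
  moreover have "1 - norm b * norm (h z) \<le> norm (1 - cnj b * h z)"
    using norm_triangle_ineq2[of 1 "cnj b * h z"] by (simp add: norm_mult)
  ultimately have "1 - norm b \<le> norm (1 - cnj b * h z)" by linarith
  then have "(1 - norm b)\<^sup>2 \<le> (norm (1 - cnj b * h z))\<^sup>2"
    using b by (intro power_mono) auto
  moreover have "0 \<le> 1 - (norm z)\<^sup>2"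
    using z by (simp add: abs_square_le_1)
  ultimately have "(1 - (norm z)\<^sup>2) * (1 - norm b)\<^sup>2 \<le> (1 - (norm b)\<^sup>2) * (1 - (norm (h z))\<^sup>2)"
    using main by (meson mult_left_mono order_trans)
  \<comment> \<open>Since \<open>1 - (norm b)\<^sup>2\<close> factors, both sides share the positive
    factor \<open>1 - norm b\<close>, which is cancelled next.\<close>
  then have "(1 - norm b) * ((1 - (norm z)\<^sup>2) * (1 - norm b))
      \<le> (1 - norm b) * ((1 + norm b) * (1 - (norm (h z))\<^sup>2))"
    by (simp add: power2_eq_square algebra_simps)
  then have "(1 - (norm z)\<^sup>2) * (1 - norm b) \<le> (1 + norm b) * (1 - (norm (h z))\<^sup>2)"
    using b by simp
  also have "\<dots> \<le> 2 * (1 - (norm (h z))\<^sup>2)"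
    using b lt[OF z] by (intro mult_right_mono) (auto simp: abs_square_le_1)
  also have "\<dots> \<le> 2 * (2 * (1 - norm (h z)))"
  proof -
    have "0 \<le> (1 - norm (h z))\<^sup>2" by simp
    then show ?thesis by (simp add: power2_eq_square algebra_simps)
  qed
  finally have "(1 - (norm z)\<^sup>2) * (1 - norm b) \<le> 4 * (1 - norm (h z))" by simp
  moreover have "(1 - norm z) * (1 - norm b) \<le> (1 - (norm z)\<^sup>2) * (1 - norm b)"
    using z b by (intro mult_right_mono) (auto simp: power2_eq_square mult_left_le)
  ultimately have "(1 - norm z) * (1 - norm b) \<le> 4 * (1 - norm (h z))" by linarith
  then show ?thesis by (simp add: b_def mult.commute)
qed

text \<open>Moebius maps on both sides move \<open>z\<close> and \<open>g z\<close> to 0. The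
  Schwarz lemma bounds the derivative of the composite \<open>k\<close> at 0 by 1, and the chain
  rule expresses that derivative through \<open>deriv g z\<close>.\<close>

lemma Schwarz_Pick_deriv:
  assumes g: "g holomorphic_on ball 0 1"
    and lt: "\<And>z. norm z < 1 \<Longrightarrow> norm (g z) < 1"
    and z: "norm z < 1"
  shows "(1 - (norm z)\<^sup>2) * norm (deriv g z) \<le> 1 - (norm (g z))\<^sup>2"
proof -
  define b where "b = g z"
  have b: "norm b < 1" unfolding b_def using lt z by simp
  have z': "norm (- z) < 1" using z by simp
  define k where "k = Moebius_function 0 b \<circ> (g \<circ> Moebius_function 0 (- z))"
  have M0: "Moebius_function 0 (- z) 0 = z" by (simp add: Moebius_function_of_zero)
  have im: "Moebius_function 0 (- z) ` ball 0 1 \<subseteq> ball 0 1"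
    using Moebius_function_norm_lt_1[OF z'] by auto
  have "norm (deriv k 0) \<le> 1"
  proof (rule Schwarz_Lemma(2))
    show "k holomorphic_on ball 0 1"
      unfolding k_def
      by (rule holomorphic_on_compose_gen[OF holomorphic_on_compose_gen[OF
            Moebius_function_holomorphic[OF z'] g im] Moebius_function_holomorphic[OF b]])
         (use lt Moebius_function_norm_lt_1[OF z'] in auto)
    show "k 0 = 0" by (simp add: k_def M0 b_def Moebius_function_eq_zero)
    show "norm (k w) < 1" if "norm w < 1" for w
      unfolding k_def using that b lt Moebius_function_norm_lt_1 z' by simp
    show "norm (0 :: complex) < 1" by simp
  qed
  moreover have "(k has_field_derivative
      (1 / (1 - (norm b)\<^sup>2)) * (deriv g z * (1 - (norm z)\<^sup>2))) (at 0)"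
    unfolding k_def
  proof (intro DERIV_chain)
    show "(Moebius_function 0 (- z) has_field_derivative (1 - (norm z)\<^sup>2)) (at 0)"
      using Moebius_function_has_field_derivative[OF z', of 0] by simp
    show "(g has_field_derivative deriv g z) (at (Moebius_function 0 (- z) 0))"
      unfolding M0 using g z by (simp add: holomorphic_derivI)
    \<comment> \<open>At its own zero \<open>b\<close> the Moebius derivative collapses to the
      reciprocal of \<open>1 - (norm b)\<^sup>2\<close>.\<close>
    have "1 - cnj b * b = of_real (1 - (norm b)\<^sup>2)"
      by (metis complex_norm_square mult.commute of_real_1 of_real_diff)
    moreover have "1 - (norm b)\<^sup>2 \<noteq> 0"
      using b abs_square_less_1[of "norm b"] by simp
    ultimately have "of_real (1 - (norm b)\<^sup>2) / (1 - cnj b * b)\<^sup>2 = 1 / of_real (1 - (norm b)\<^sup>2)"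
      by (simp add: power2_eq_square)
    then show "(Moebius_function 0 b has_field_derivative (1 / (1 - (norm b)\<^sup>2)))
        (at ((g \<circ> Moebius_function 0 (- z)) 0))"
      using Moebius_function_has_field_derivative[OF b b] by (simp add: M0 b_def)
  qed
  ultimately have "norm (of_real (1 / (1 - (norm b)\<^sup>2)) * (deriv g z * of_real (1 - (norm z)\<^sup>2))) \<le> 1"
    by (metis DERIV_imp_deriv)
  moreover have "0 < 1 - (norm b)\<^sup>2" "0 < 1 - (norm z)\<^sup>2"
    using b z by (simp_all add: abs_square_less_1)
  ultimately show ?thesis
    unfolding norm_mult norm_of_real by (simp add: field_simps b_def)
qed

text \<open>Not being a rotation excludes the equality case of the Schwarz lemma, so the quotient
  \<open>h\<close> maps the disc into the open disc, and \<open>Schwarz_Pick_gap\<close> applies to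
  it.\<close>

lemma disc_contraction:
  assumes f: "f holomorphic_on ball 0 1" and self: "f ` ball 0 1 \<subseteq> ball 0 1"
    and f0: "f 0 = 0" and nr: "\<not> is_rotation f"
  obtains c where "0 < c" "c \<le> 1"
    "\<And>z. norm z < 1 \<Longrightarrow> norm (f z) \<le> norm z * (1 - c * (1 - norm z))"
proof -
  have lt: "norm (f z) < 1" if "norm z < 1" for z
    using self that by (simp add: image_subset_iff)
  obtain h where h: "h holomorphic_on ball 0 1" "\<And>z. norm z < 1 \<Longrightarrow> f z = z * h z" "deriv f 0 = h 0"
    using Schwarz3[OF f f0] by blast
  have no: "\<not> ((\<exists>z. norm z < 1 \<and> z \<noteq> 0 \<and> norm (f z) = norm z) \<or> norm (deriv f 0) = 1)"
  proof
    assume "(\<exists>z. norm z < 1 \<and> z \<noteq> 0 \<and> norm (f z) = norm z) \<or> norm (deriv f 0) = 1"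
    from Schwarz_Lemma(3)[OF f f0 lt _ this, of 0]
    obtain \<alpha> where "\<forall>z. norm z < 1 \<longrightarrow> f z = \<alpha> * z" "norm \<alpha> = 1" by auto
    then show False using nr unfolding is_rotation_def by (metis mem_ball_0)
  qed
  \<comment> \<open>At 0 the quotient equals \<open>deriv f 0\<close>, so the derivative part of the
    Schwarz lemma is used there.\<close>
  have hlt: "norm (h z) < 1" if "norm z < 1" for z
  proof (cases "z = 0")
    case True
    then show ?thesis
      using Schwarz_Lemma(2)[OF f f0 lt, of 0] no h(3) by auto
  next
    case False
    have "norm (f z) < norm z"
      using Schwarz_Lemma(1)[OF f f0 lt that] no False that by fastforce
    then show ?thesis
      using False h(2)[OF that] by (simp add: norm_mult)
  qed
  show ?thesis
  proof (rule that[of "(1 - norm (h 0)) / 4"])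
    show "0 < (1 - norm (h 0)) / 4" using hlt[of 0] by simp
    show "(1 - norm (h 0)) / 4 \<le> 1" by (rule order_trans[of _ "1 / 4"]) simp_all
    fix z :: complex assume z: "norm z < 1"
    then show "norm (f z) \<le> norm z * (1 - (1 - norm (h 0)) / 4 * (1 - norm z))"
      unfolding h(2)[OF z] norm_mult
      using Schwarz_Pick_gap[OF h(1) hlt z] by (intro mult_left_mono) auto
  qed
qed

section \<open>Iterates under the contraction estimate, with bounds depending on \<open>f\<close>
  through \<open>c\<close> only\<close>

context
  fixes f :: "complex \<Rightarrow> complex" and c :: real
  assumes hol: "f holomorphic_on ball 0 1"
    and c: "0 < c" "c \<le> 1"
    and contr: "\<And>z. norm z < 1 \<Longrightarrow> norm (f z) \<le> norm z * (1 - c * (1 - norm z))"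
begin

lemma factor_bounds:
  assumes "0 \<le> s" "s < 1"
  shows "0 \<le> 1 - c * (1 - s)" "1 - c * (1 - s) < 1"
  using assms c by (auto intro: mult_le_one)

text \<open>The orbit never leaves the disc of radius \<open>s\<close>, so every step contracts at
  least by the factor belonging to \<open>s\<close>. Using \<open>s\<close> instead of
  \<open>norm z\<close> makes the rate uniform on that disc.\<close>

lemma funpow_decay:
  assumes s: "norm z \<le> s" "s < 1"
  shows "norm ((f ^^ n) z) \<le> norm z * (1 - c * (1 - s)) ^ n"
proof (induction n)
  case (Suc n)
  have s0: "0 \<le> s" using s norm_ge_zero order_trans by blast
  note fb = factor_bounds[OF s0 s(2)]
  have "(1 - c * (1 - s)) ^ n \<le> 1" using fb by (simp add: power_le_one)
  then have "norm z * (1 - c * (1 - s)) ^ n \<le> norm z" by (simp add: mult_left_le)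
  then have le: "norm ((f ^^ n) z) \<le> s" using Suc s by linarith
  have "norm ((f ^^ Suc n) z) \<le> norm ((f ^^ n) z) * (1 - c * (1 - norm ((f ^^ n) z)))"
    using contr[of "(f ^^ n) z"] le s by simp
  also have "\<dots> \<le> norm ((f ^^ n) z) * (1 - c * (1 - s))"
    using le c by (intro mult_left_mono) auto
  also have "\<dots> \<le> norm z * (1 - c * (1 - s)) ^ n * (1 - c * (1 - s))"
    using Suc fb by (intro mult_right_mono) auto
  finally show ?case by (simp add: mult_ac)
qed simp

lemma funpow_disc:
  assumes "norm z < 1"
  shows "norm ((f ^^ n) z) < 1"
proof -
  have "norm z * (1 - c * (1 - norm z)) ^ n \<le> norm z"
    using factor_bounds[of "norm z"] assms by (intro mult_left_le power_le_one) auto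
  then show ?thesis using funpow_decay[OF order_refl assms, of n] assms by linarith
qed

lemma self_map: "norm z < 1 \<Longrightarrow> norm (f z) < 1"
  using funpow_disc[of z 1] by simp

lemma funpow_holomorphic: "(f ^^ n) holomorphic_on ball 0 1"
proof (induction n)
  case 0
  have "f ^^ 0 = (\<lambda>z. z)" by auto
  then show ?case by (metis holomorphic_on_ident)
next
  case (Suc n)
  show ?case
    unfolding funpow.simps
    by (rule holomorphic_on_compose_gen[OF Suc hol]) (use funpow_disc in auto)
qed

section \<open>Derivatives of the iterates and their weighted sum\<close>

lemma deriv_funpow_Suc:
  assumes "norm z < 1"
  shows "deriv (f ^^ Suc n) z = deriv (f ^^ n) (f z) * deriv f z"
  unfolding funpow_Suc_right
  using assms self_map[OF assms] hol funpow_holomorphic[of n]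
  by (intro deriv_chain holomorphic_on_imp_differentiable_at[of _ "ball 0 1"]) auto

text \<open>Cauchy's estimate on the circle of radius 1/4 about \<open>z\<close>: it lies in the
  disc of radius 3/4, where \<open>funpow_decay\<close> has rate \<open>1 - c / 4\<close>, and the
  factor 4 is the reciprocal radius.\<close>

lemma deriv_funpow_inner:
  assumes z: "norm z \<le> 1 / 2"
  shows "norm (deriv (f ^^ n) z) \<le> 4 * (1 - c / 4) ^ n"
proof -
  have sub: "cball z (1/4) \<subseteq> ball 0 1"
  proof
    fix w assume "w \<in> cball z (1/4)"
    then have "norm (w - z) \<le> 1/4" by (simp add: dist_norm norm_minus_commute)
    then show "w \<in> ball 0 1" using z norm_triangle_sub[of w z] by simp
  qed
  have "norm ((deriv ^^ 1) (f ^^ n) z) \<le> fact 1 * (1 - c / 4) ^ n / (1/4) ^ 1"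
  proof (rule Cauchy_inequality)
    show "(f ^^ n) holomorphic_on ball z (1/4)"
      using funpow_holomorphic ball_subset_cball sub by (meson holomorphic_on_subset)
    show "continuous_on (cball z (1/4)) (f ^^ n)"
      using funpow_holomorphic sub by (meson holomorphic_on_subset holomorphic_on_imp_continuous_on)
    show "norm ((f ^^ n) x) \<le> (1 - c / 4) ^ n" if x: "norm (z - x) = 1/4" for x
    proof -
      have le: "norm x \<le> 3/4"
        using x z norm_triangle_sub[of x z] by (simp add: norm_minus_commute)
      have "norm ((f ^^ n) x) \<le> norm x * (1 - c / 4) ^ n"
        using funpow_decay[OF le, of n] by simp
      also have "\<dots> \<le> 1 * (1 - c / 4) ^ n"
        using le c by (intro mult_right_mono) auto
      finally show ?thesis by simp
    qed
  qed auto
  then show ?thesis by simp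
qed

text \<open>
  By the chain rule and the Schwarz--Pick inequality, the sum \<open>T\<^sub>m z\<close> satisfies
  \<open>T\<^bsub>m+1\<^esub> z \<le> 1 - \<bar>z\<bar>\<^sup>2 + T\<^sub>m (f z)\<close>. The correction \<open>4 / c * (1 - \<bar>z\<bar>)\<close> in the bound makes the
  induction on \<open>m\<close> work near the boundary, where \<open>f\<close> enlarges \<open>1 - \<bar>z\<bar>\<close> by a factor of at least
  \<open>1 + c / 2\<close>.
\<close>

lemma sum_deriv_funpow_bound:
  assumes "norm z < 1"
  shows "(\<Sum>n<m. (1 - (norm z)\<^sup>2) * norm (deriv (f ^^ n) z)) \<le> 20 / c - 4 / c * (1 - norm z)"
  using assms
proof (induction m arbitrary: z)
  case 0
  have "4 / c * (1 - norm z) \<le> 4 / c * 1"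
    using c by (intro mult_left_mono) auto
  also have "\<dots> \<le> 20 / c" using c by (simp add: divide_right_mono)
  finally show ?case by simp
next
  case (Suc m)
  have pos: "0 < 1 - (norm z)\<^sup>2" using Suc.prems by (simp add: abs_square_less_1)
  show ?case
  proof (cases "norm z \<le> 1 / 2")
    case True
    have "(\<Sum>n<Suc m. (1 - (norm z)\<^sup>2) * norm (deriv (f ^^ n) z)) \<le> (\<Sum>n<Suc m. 1 * (4 * (1 - c / 4) ^ n))"
      using pos by (intro sum_mono mult_mono deriv_funpow_inner True) auto
    also have "\<dots> = 4 * (\<Sum>n<Suc m. (1 - c / 4) ^ n)" by (simp only: sum_distrib_left mult_1)
    also have "\<dots> \<le> 4 * (\<Sum>n. (1 - c / 4) ^ n)"
      using c by (intro mult_left_mono sum_le_suminf summable_geometric) auto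
    also have "\<dots> = 16 / c" using c by (simp add: suminf_geometric)
    \<comment> \<open>The constant \<open>20 / c\<close> is this \<open>16 / c\<close> plus
      \<open>4 / c\<close>, an upper bound for the correction.\<close>
    also have "\<dots> \<le> 20 / c - 4 / c * (1 - norm z)"
      using c by (simp add: field_simps)
    finally show ?thesis .
  next
    case False
    define w where "w = f z"
    have w: "norm w < 1" unfolding w_def by (rule self_map[OF Suc.prems])
    have pw: "0 < 1 - (norm w)\<^sup>2" using w by (simp add: abs_square_less_1)
    have SP: "(1 - (norm z)\<^sup>2) * norm (deriv f z) \<le> 1 - (norm w)\<^sup>2"
      unfolding w_def by (rule Schwarz_Pick_deriv[OF hol self_map Suc.prems])
    have id: "f ^^ 0 = (\<lambda>z. z)" by auto
    \<comment> \<open>The term \<open>n = 0\<close> is split off; the identity has derivative 1. The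
      remaining terms are compared with the sum at \<open>w\<close>.\<close>
    have "(\<Sum>n<Suc m. (1 - (norm z)\<^sup>2) * norm (deriv (f ^^ n) z))
        = (1 - (norm z)\<^sup>2) + (\<Sum>n<m. (1 - (norm z)\<^sup>2) * norm (deriv (f ^^ Suc n) z))"
      unfolding sum.lessThan_Suc_shift id by simp
    also have "\<dots> \<le> (1 - (norm z)\<^sup>2) + (\<Sum>n<m. (1 - (norm w)\<^sup>2) * norm (deriv (f ^^ n) w))"
    proof (intro add_left_mono sum_mono)
      fix n
      have "(1 - (norm z)\<^sup>2) * norm (deriv (f ^^ Suc n) z)
          = ((1 - (norm z)\<^sup>2) * norm (deriv f z)) * norm (deriv (f ^^ n) w)"
        unfolding deriv_funpow_Suc[OF Suc.prems] norm_mult w_def by simp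
      also have "\<dots> \<le> (1 - (norm w)\<^sup>2) * norm (deriv (f ^^ n) w)"
        by (intro mult_right_mono SP) auto
      finally show "(1 - (norm z)\<^sup>2) * norm (deriv (f ^^ Suc n) z)
          \<le> (1 - (norm w)\<^sup>2) * norm (deriv (f ^^ n) w)" .
    qed
    also have "\<dots> \<le> (1 - (norm z)\<^sup>2) + (20 / c - 4 / c * (1 - norm w))"
      using Suc.IH[OF w] by simp
    also have "\<dots> \<le> 2 * (1 - norm z) + (20 / c - 4 / c * (1 - norm w))"
    proof -
      have "0 \<le> (1 - norm z)\<^sup>2" by simp
      then show ?thesis by (simp add: power2_eq_square algebra_simps)
    qed
    \<comment> \<open>As \<open>norm z > 1/2\<close>, \<open>contr\<close> gives
      \<open>1 - norm w \<ge> (1 + c / 2) * (1 - norm z)\<close>. The coefficient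
      \<open>4 / c\<close> makes the resulting gain equal to the surplus
      \<open>2 * (1 - norm z)\<close>.\<close>
    also have "\<dots> \<le> 20 / c - 4 / c * (1 - norm z)"
    proof -
      have "1/2 * (c * (1 - norm z)) \<le> norm z * (c * (1 - norm z))"
        using False c Suc.prems by (intro mult_right_mono) auto
      then have "(1 - norm z) + 1/2 * (c * (1 - norm z)) \<le> 1 - norm w"
        using contr[OF Suc.prems] unfolding w_def by (simp add: algebra_simps)
      then have "4 / c * ((1 - norm z) + 1/2 * (c * (1 - norm z))) \<le> 4 / c * (1 - norm w)"
        using c by (intro mult_left_mono) auto
      moreover have "4 / c * ((1 - norm z) + 1/2 * (c * (1 - norm z)))
          = 4 / c * (1 - norm z) + 2 * (1 - norm z)"
        using c by (simp add: field_simps)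
      ultimately show ?thesis by linarith
    qed
    finally show ?thesis .
  qed
qed

section \<open>Termwise differentiation of the series and its Bloch estimate\<close>

lemma iterate_series_bloch_estimate:
  assumes a: "\<And>n. n \<ge> 1 \<Longrightarrow> norm (a n) \<le> M" and M: "0 \<le> M"
  shows "iterate_series a f holomorphic_on ball 0 1"
    and "norm z < 1 \<Longrightarrow> (1 - (norm z)\<^sup>2) * norm (deriv (iterate_series a f) z) \<le> 20 / c * M"
proof -
  let ?u = "\<lambda>n z. a (Suc n) * (f ^^ Suc n) z"
  let ?u' = "\<lambda>n z. a (Suc n) * deriv (f ^^ Suc n) z"
  have "\<exists>g g'. \<forall>x \<in> ball 0 1. ((\<lambda>n. ?u n x) sums g x) \<and> ((\<lambda>n. ?u' n x) sums g' x)
      \<and> (g has_field_derivative g' x) (at x)"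
  \<comment> \<open>A locally uniform summable majorant of the terms themselves suffices for
    termwise differentiation.\<close>
  proof (rule series_and_derivative_comparison_local)
    show "open (ball 0 1 :: complex set)" by simp
    show "(?u n has_field_derivative ?u' n x) (at x)" if "x \<in> ball 0 1" for n x
      by (intro DERIV_cmult holomorphic_derivI[OF funpow_holomorphic open_ball that])
    fix x :: complex assume x: "x \<in> ball 0 1"
    \<comment> \<open>The midpoint of \<open>norm x\<close> and 1: the ball about \<open>x\<close>
      of radius \<open>s - norm x\<close> stays in the disc of radius \<open>s\<close>, where
      \<open>funpow_decay\<close> is uniform.\<close>
    define s where "s = (norm x + 1) / 2"
    have s: "0 \<le> s" "s < 1" "norm x < s"
      using x by (auto simp: s_def)
    define q where "q = 1 - c * (1 - s)"
    have q: "0 \<le> q" "q < 1" unfolding q_def using factor_bounds s by auto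
    show "\<exists>d h. 0 < d \<and> summable h \<and>
        (\<forall>\<^sub>F n in sequentially. \<forall>y\<in>ball x d \<inter> ball 0 1. norm (?u n y) \<le> h n)"
    proof (intro exI conjI always_eventually allI ballI)
      show "0 < s - norm x" using s by simp
      show "summable (\<lambda>n. M * q ^ Suc n)"
        using q by (intro summable_mult) (simp add: summable_geometric summable_mult)
      fix n y assume y: "y \<in> ball x (s - norm x) \<inter> ball 0 1"
      then have "norm (y - x) < s - norm x" by (simp add: dist_norm norm_minus_commute)
      then have ys: "norm y \<le> s" using norm_triangle_sub[of y x] by simp
      have "norm ((f ^^ Suc n) y) \<le> norm y * q ^ Suc n"
        unfolding q_def by (rule funpow_decay[OF ys s(2)])
      also have "\<dots> \<le> q ^ Suc n"
        using q y by (intro mult_left_le_one_le) auto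
      finally show "norm (?u n y) \<le> M * q ^ Suc n"
        unfolding norm_mult using a M by (intro mult_mono) auto
    qed
  qed
  then obtain g g' where g: "\<And>x. x \<in> ball 0 1 \<Longrightarrow> (\<lambda>n. ?u n x) sums g x"
      "\<And>x. x \<in> ball 0 1 \<Longrightarrow> (\<lambda>n. ?u' n x) sums g' x"
      "\<And>x. x \<in> ball 0 1 \<Longrightarrow> (g has_field_derivative g' x) (at x)"
    by blast
  have eq: "iterate_series a f x = g x" if "x \<in> ball 0 1" for x
    unfolding iterate_series_def using sums_unique[OF g(1)[OF that]] by simp
  have D: "(iterate_series a f has_field_derivative g' x) (at x)" if "x \<in> ball 0 1" for x
    by (rule has_field_derivative_transform_within_open[OF g(3)[OF that] open_ball that])
       (simp add: eq)
  then show "iterate_series a f holomorphic_on ball 0 1"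
    using holomorphic_on_open[OF open_ball] by blast
  assume z: "norm z < 1"
  then have pos: "0 \<le> 1 - (norm z)\<^sup>2" by (simp add: abs_square_le_1)
  \<comment> \<open>The estimate is proved for partial sums, uniformly in \<open>m\<close>, and then
    passes to the limit \<open>g' z\<close>.\<close>
  have bound: "norm (of_real (1 - (norm z)\<^sup>2) * (\<Sum>n<m. ?u' n z)) \<le> 20 / c * M" for m
  proof -
    have "norm (of_real (1 - (norm z)\<^sup>2) * (\<Sum>n<m. ?u' n z))
        \<le> (1 - (norm z)\<^sup>2) * (\<Sum>n<m. M * norm (deriv (f ^^ Suc n) z))"
      unfolding norm_mult norm_of_real abs_of_nonneg[OF pos]
      using pos a by (intro mult_left_mono sum_norm_le) (auto simp: norm_mult intro!: mult_right_mono)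
    also have "\<dots> = M * (\<Sum>n<m. (1 - (norm z)\<^sup>2) * norm (deriv (f ^^ Suc n) z))"
      by (simp add: sum_distrib_left mult_ac)
    \<comment> \<open>The series starts at the first iterate; adding the nonnegative term
      \<open>n = 0\<close> matches the sum in \<open>sum_deriv_funpow_bound\<close>.\<close>
    also have "\<dots> \<le> M * (\<Sum>n<Suc m. (1 - (norm z)\<^sup>2) * norm (deriv (f ^^ n) z))"
      unfolding sum.lessThan_Suc_shift using pos M by (intro mult_left_mono) auto
    also have "\<dots> \<le> M * (20 / c - 4 / c * (1 - norm z))"
      by (intro mult_left_mono sum_deriv_funpow_bound z M)
    also have "\<dots> \<le> M * (20 / c)"
      using c z M by (intro mult_left_mono) auto
    finally show ?thesis by (simp add: mult_ac)
  qed
  have "(\<lambda>m. norm (of_real (1 - (norm z)\<^sup>2) * (\<Sum>n<m. ?u' n z)))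
      \<longlonglongrightarrow> norm (of_real (1 - (norm z)\<^sup>2) * g' z)"
    using g(2)[of z] z unfolding sums_def by (intro tendsto_intros) auto
  then have "norm (of_real (1 - (norm z)\<^sup>2) * g' z) \<le> 20 / c * M"
    by (rule LIMSEQ_le_const2) (use bound in auto)
  moreover have "deriv (iterate_series a f) z = g' z"
    using D z by (simp add: DERIV_imp_deriv)
  ultimately show "(1 - (norm z)\<^sup>2) * norm (deriv (iterate_series a f) z) \<le> 20 / c * M"
    unfolding norm_mult norm_of_real abs_of_nonneg[OF pos] by simp
qed

end

theorem theorem4p3:
  fixes f :: "complex \<Rightarrow> complex"
  assumes "inner_function f"
    and "f 0 = 0"
    and "\<not> is_rotation f"
  shows "\<exists>C>0. \<forall>a :: nat \<Rightarrow> complex. bounded (a ` {1..}) \<longrightarrow>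
           iterate_series a f \<in> bloch_space \<and>
           bloch_norm (iterate_series a f) \<le> C * (SUP n\<in>{1..}. cmod (a n))"
proof -
  have hol: "f holomorphic_on ball 0 1" and self: "f ` ball 0 1 \<subseteq> ball 0 1"
    using assms(1) unfolding inner_function_def by auto
  obtain c where c: "0 < c" "c \<le> 1"
    "\<And>z. norm z < 1 \<Longrightarrow> norm (f z) \<le> norm z * (1 - c * (1 - norm z))"
    using disc_contraction[OF hol self assms(2,3)] by blast
  show ?thesis
  \<comment> \<open>The witness is fixed before \<open>a\<close>, and \<open>c\<close> was obtained
    from \<open>f\<close> alone.\<close>
  proof (intro exI[of _ "20 / c"] conjI allI impI)
    show "0 < 20 / c" using c by simp
    fix a :: "nat \<Rightarrow> complex" assume bdd: "bounded (a ` {1..})"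
    define M where "M = (SUP n\<in>{1..}. cmod (a n))"
    \<comment> \<open>A real \<open>SUP\<close> dominates its family only if the family is bounded
      above; boundedness of \<open>a\<close> supplies this.\<close>
    have "bdd_above ((\<lambda>n. cmod (a n)) ` {1..})"
      using bdd unfolding bounded_iff by (force simp: bdd_above_def)
    then have aM: "cmod (a n) \<le> M" if "n \<ge> 1" for n
      unfolding M_def using that by (intro cSUP_upper) auto
    have M: "0 \<le> M" using aM[of 1] norm_ge_zero order_trans by blast
    note est = iterate_series_bloch_estimate[OF hol c aM M]
    show "iterate_series a f \<in> bloch_space"
      unfolding bloch_space_def using est by (auto intro!: bdd_aboveI2[where M = "20 / c * M"])
    show "bloch_norm (iterate_series a f) \<le> 20 / c * (SUP n\<in>{1..}. cmod (a n))"
      unfolding bloch_norm_def M_def[symmetric] using est(2) by (intro cSUP_least) auto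
  qed
qed

end
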